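(* For every integer $k\ge 2$, the formal power series $$F_k(x,p,q):=\sum_{n\ge 1}x^n\sum_{w\in\mathcal F_{n,k}}p^{\mathrm{sper}(P(w))}q^{\mathrm{area}(P(w))}$$ is equal to $$F_k(x,p,q)=\frac{p^2\left((q+pq^2)x-(pq^3-p^2q^3)x^2-p^kq^{2k}x^k-p^{k+1}q^{2k+1}x^{k+1}\right)}{1-(pq+pq^2)x+(p^2q^3-p^3q^3)x^2+p^{k+2}q^{2k+1}x^{k+1}}.$$
   Context: For integers $k\ge 2$ and $n\ge 1$, $\mathcal F_{n,k}$ denotes the set of binary words $w=w_1\cdots w_n\in\{0,1\}^n$ that do not contain $k$ consecutive $1$'s ($k$-bonacci words). To $w\in\mathcal F_{n,k}$ one associates the bargraph polyomino $P(w)$ (a $k$-bonacci polyomino): $n$ columns of unit cells standing side by side on a common horizontal base line, the $i$-th column consisting of $w_i+1$ cells, i.e. $P(w)$ is the union of the unit squares $[i-1,i]\times[j-1,j]$ for $1\le i\le n$, $1\le j\le w_i+1$. $\mathrm{area}(P)$ is the number of cells of $P$ and $\mathrm{sper}(P)$ is its semiperimeter (half of its perimeter). *)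

theory Defs
  imports
    "HOL-Library.Sublist"
    "HOL-Library.Product_Plus"
    "HOL-Computational_Algebra.Formal_Power_Series"
begin

definition kbonacci_words :: "nat \<Rightarrow> nat \<Rightarrow> nat list set" where
  "kbonacci_words n k =
     {w. length w = n \<and> set w \<subseteq> {0, 1} \<and> \<not> sublist (replicate k 1) w}"

text \<open>
  The pair \<open>(i, j)\<close> stands for the unit square \<open>[i - 1, i] \<times> [j - 1, j]\<close>.
\<close>

type_synonym cell = "int \<times> int"

definition bargraph :: "nat list \<Rightarrow> cell set" where
  "bargraph w =
     {(i, j). 1 \<le> i \<and> i \<le> int (length w) \<and> 1 \<le> j \<and> j \<le> int (w ! nat (i - 1)) + 1}"

definition area :: "cell set \<Rightarrow> nat" where
  "area P = card P"

definition adjacent :: "cell \<Rightarrow> cell \<Rightarrow> bool" where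
  "adjacent c d \<longleftrightarrow> \<bar>fst c - fst d\<bar> + \<bar>snd c - snd d\<bar> = 1"

text \<open>
  Each unit edge of the boundary of \<open>P\<close> separates exactly one cell inside \<open>P\<close> from exactly
  one cell outside \<open>P\<close>, so the perimeter is the number of such pairs.
\<close>

definition perimeter :: "cell set \<Rightarrow> nat" where
  "perimeter P = card {(c, d). c \<in> P \<and> d \<notin> P \<and> adjacent c d}"

definition sper :: "cell set \<Rightarrow> nat" where
  "sper P = perimeter P div 2"

text \<open>The division in the semiperimeter never rounds.\<close>

lemma even_perimeter:
  assumes "finite P"
  shows "even (perimeter P)"
proof -
  define B where "B v = (\<lambda>c. (c, c + v)) ` {c \<in> P. c + v \<notin> P}" for v :: cell
  have finB: "finite (B v)" for v
    using assms by (simp add: B_def)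
  have cardB: "card (B v) = card {c \<in> P. c + v \<notin> P}" for v
    unfolding B_def by (rule card_image) (simp add: inj_on_def)
  have opp: "card (B (- v)) = card (B v)" for v
  proof -
    have "card {c \<in> P. c + v \<in> P} = card {c \<in> P. c + - v \<in> P}"
      by (rule bij_betw_same_card[of "\<lambda>c. c + v"],
          rule bij_betw_byWitness[where f' = "\<lambda>c. c + - v"]) auto
    moreover have "card {c \<in> P. c + u \<notin> P} = card P - card {c \<in> P. c + u \<in> P}" for u
    proof -
      have "{c \<in> P. c + u \<notin> P} = P - {c \<in> P. c + u \<in> P}" by auto
      then show ?thesis using assms by (simp add: card_Diff_subset)
    qed
    ultimately show ?thesis by (simp only: cardB)
  qed
  have disj: "B u \<inter> B v = {}" if "u \<noteq> v" for u v
    using that by (auto simp: B_def)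
  have unit: "\<bar>a\<bar> + \<bar>b\<bar> = 1 \<longleftrightarrow>
      (a, b) = (1, 0) \<or> (a, b) = (-1, 0) \<or> (a, b) = (0, 1) \<or> (a, b) = (0, -1)" for a b :: int
    by auto
  have "{(c, d). c \<in> P \<and> d \<notin> P \<and> adjacent c d} =
      (\<Union>v \<in> {v. \<bar>fst v\<bar> + \<bar>snd v\<bar> = 1}. B v)"
  proof (intro set_eqI iffI)
    fix e assume "e \<in> {(c, d). c \<in> P \<and> d \<notin> P \<and> adjacent c d}"
    then obtain c d where e: "e = (c, d)" "c \<in> P" "d \<notin> P" "adjacent c d" by auto
    have "e \<in> B (d - c)" using e by (auto simp: B_def)
    moreover have "\<bar>fst (d - c)\<bar> + \<bar>snd (d - c)\<bar> = 1"
      using e(4) by (simp add: adjacent_def abs_minus_commute)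
    ultimately show "e \<in> (\<Union>v \<in> {v. \<bar>fst v\<bar> + \<bar>snd v\<bar> = 1}. B v)" by blast
  qed (auto simp: B_def adjacent_def)
  also have "{v :: cell. \<bar>fst v\<bar> + \<bar>snd v\<bar> = 1} = {(1, 0), - (1, 0), (0, 1), - (0, 1)}"
    by (auto simp: unit)
  finally have "perimeter P = card (\<Union>v \<in> {(1, 0), - (1, 0), (0, 1), - (0, 1)}. B v)"
    by (simp add: perimeter_def)
  also have "\<dots> = (\<Sum>v \<in> {(1, 0), - (1, 0), (0, 1), - (0, 1)}. card (B v))"
    by (rule card_UN_disjoint) (simp_all add: finB disj)
  also have "\<dots> = card (B (1, 0)) + card (B (- (1, 0))) + card (B (0, 1)) + card (B (- (0, 1)))"
    by simp
  also have "\<dots> = 2 * (card (B (1, 0)) + card (B (0, 1)))"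
    by (simp only: opp) simp
  finally show ?thesis by simp
qed

lemma finite_bargraph: "finite (bargraph w)"
proof (rule finite_subset)
  show "bargraph w \<subseteq>
      (SIGMA i : {1..int (length w)}. {1..int (w ! nat (i - 1)) + 1})"
    by (auto simp: bargraph_def)
qed auto

text \<open>
  Formal power series in \<open>x\<close>, \<open>p\<close>, \<open>q\<close> are iterated univariate ones: the outermost
  variable is \<open>x\<close>, the next one \<open>p\<close>, the innermost one \<open>q\<close>. Rational rather than
  integer coefficients are used because the library's division of power series needs an
  inverse on the coefficients.
\<close>

type_synonym series = "rat fps fps fps"

definition X_var :: series where "X_var = fps_X"
definition P_var :: series where "P_var = fps_const fps_X"
definition Q_var :: series where "Q_var = fps_const (fps_const fps_X)"

definition kbonacci_gf :: "nat \<Rightarrow> series" where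
  "kbonacci_gf k = Abs_fps (\<lambda>n. if n = 0 then 0 else
     \<Sum>w \<in> kbonacci_words n k.
       fps_X ^ sper (bargraph w) * fps_const fps_X ^ area (bargraph w))"

lemma kbonacci_gf_sums:
  "(\<lambda>n. if n = 0 then 0 else
      X_var ^ n * (\<Sum>w \<in> kbonacci_words n k.
        P_var ^ sper (bargraph w) * Q_var ^ area (bargraph w))) sums kbonacci_gf k"
proof -
  have c: "fps_const (\<Sum>w \<in> A. f w) = (\<Sum>w \<in> A. fps_const (f w))"
    for f :: "nat list \<Rightarrow> rat fps fps" and A
    by (induction A rule: infinite_finite_induct) (simp_all flip: fps_const_add)
  have t: "(if n = 0 then 0 else
      X_var ^ n * (\<Sum>w \<in> kbonacci_words n k.
        P_var ^ sper (bargraph w) * Q_var ^ area (bargraph w)))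
      = fps_const (fps_nth (kbonacci_gf k) n) * fps_X ^ n" for n
    by (simp add: X_var_def P_var_def Q_var_def kbonacci_gf_def c mult.commute
             flip: fps_const_mult fps_const_power)
  show ?thesis
    unfolding t sums_def_le by (simp add: fps_notation atLeast0AtMost[symmetric])
qed

text \<open>
  A series with constant term \<open>1\<close> is invertible, and the library's division by it is the
  genuine one, although the coefficient ring is not a field.
\<close>

lemma series_divide_eq_iff:
  fixes f g h :: series
  assumes "fps_nth g 0 = 1"
  shows "h = f / g \<longleftrightarrow> h * g = f"
proof -
  have one: "inverse (1 :: rat fps fps) = 1"
    by (rule fps_inverse_one') simp
  have "inverse g = fps_right_inverse g 1"
    by (simp only: fps_inverse_def[of g] assms one)
  moreover have "g * fps_right_inverse g 1 = 1"
    by (rule fps_right_inverse) (simp add: assms)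
  ultimately have inv: "g * inverse g = 1" by simp
  have "subdegree g = 0" using assms by (simp add: subdegree_eq_0_iff)
  then have d: "f / g = f * inverse g"
    by (simp add: fps_divide_def)
  have "h * g * inverse g = h" "f * inverse g * g = f"
    using inv by (simp_all add: mult.assoc mult.commute[of "inverse g"])
  then show ?thesis
    unfolding d by (metis (no_types))
qed

end

theory Submission
  imports Defs
begin

text \<open>
  A binary word is either \<open>1\<^sup>i\<close> or \<open>w 0 1\<^sup>i\<close> for a unique word \<open>w\<close> and a unique \<open>i\<close>, and it avoids
  \<open>1\<^sup>k\<close> iff \<open>i < k\<close> and \<open>w\<close> avoids \<open>1\<^sup>k\<close>. Appending a column of height \<open>h\<close> after one of
  height \<open>h'\<close> adds \<open>h\<close> to the area and \<open>1 + max 0 (h - h')\<close> to the semiperimeter.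
  With \<open>u = p q x\<close>, \<open>v = p q\<^sup>2 x\<close> and \<open>R = 1 + p (v + \<dots> + v\<^sup>k\<^sup>-\<^sup>1)\<close>, the series
  \<open>G = p + F\<^sub>k\<close>, in which the empty word has weight \<open>p\<close>, therefore satisfies
  \<open>G = p R + R u G\<close>; multiplying by \<open>1 - v\<close> sums the geometric progression in \<open>R\<close>.
\<close>

section \<open>Area and semiperimeter of bargraphs\<close>

text \<open>A boundary edge is coded by its inner cell and the unit step \<open>v\<close> leaving
  it. The difference of the two cells recovers \<open>v\<close>, so the four images
  \<open>B v\<close> are disjoint.\<close>

lemma perimeter_eq_sum_directions:
  assumes "finite P"
  shows "perimeter P = (\<Sum>v\<in>{(1, 0), (- 1, 0), (0, 1), (0, - 1)}. card {c \<in> P. c + v \<notin> P})"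
proof -
  define B where "B v = (\<lambda>c. (c, c + v)) ` {c \<in> P. c + v \<notin> P}" for v :: cell
  have cardB: "card (B v) = card {c \<in> P. c + v \<notin> P}" for v
    unfolding B_def by (rule card_image) (simp add: inj_on_def)
  have unit: "\<bar>a\<bar> + \<bar>b\<bar> = 1 \<longleftrightarrow>
      (a, b) = (1, 0) \<or> (a, b) = (-1, 0) \<or> (a, b) = (0, 1) \<or> (a, b) = (0, -1)" for a b :: int
    by auto
  have "{(c, d). c \<in> P \<and> d \<notin> P \<and> adjacent c d} =
      (\<Union>v \<in> {(1, 0), (- 1, 0), (0, 1), (0, - 1)}. B v)"
  proof (intro set_eqI iffI)
    fix e assume "e \<in> {(c, d). c \<in> P \<and> d \<notin> P \<and> adjacent c d}"
    then obtain c d where e: "e = (c, d)" "c \<in> P" "d \<notin> P" "adjacent c d" by auto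
    have "e \<in> B (d - c)" using e by (auto simp: B_def)
    moreover have "\<bar>fst (d - c)\<bar> + \<bar>snd (d - c)\<bar> = 1"
      using e(4) by (simp add: adjacent_def abs_minus_commute)
    then have "d - c \<in> {(1, 0), (- 1, 0), (0, 1), (0, - 1)}"
      unfolding unit by (metis insert_iff prod.collapse)
    ultimately show "e \<in> (\<Union>v \<in> {(1, 0), (- 1, 0), (0, 1), (0, - 1)}. B v)" by blast
  qed (auto simp: B_def adjacent_def)
  then have "perimeter P = card (\<Union>v \<in> {(1, 0), (- 1, 0), (0, 1), (0, - 1)}. B v)"
    by (simp add: perimeter_def)
  also have "\<dots> = (\<Sum>v \<in> {(1, 0), (- 1, 0), (0, 1), (0, - 1)}. card (B v))"
    by (rule card_UN_disjoint) (use assms in \<open>auto simp: B_def\<close>)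
  finally show ?thesis by (simp only: cardB)
qed

text \<open>Translation by \<open>v\<close> matches the cells whose neighbour at \<open>v\<close> is
  in \<open>P\<close> with those whose neighbour at \<open>- v\<close> is; finiteness permits
  passing to complements.\<close>

lemma card_exposed_opposite:
  fixes P :: "cell set"
  assumes "finite P"
  shows "card {c \<in> P. c + - v \<notin> P} = card {c \<in> P. c + v \<notin> P}"
proof -
  have "card {c \<in> P. c + v \<in> P} = card {c \<in> P. c + - v \<in> P}"
    by (rule bij_betw_same_card[of "\<lambda>c. c + v"],
        rule bij_betw_byWitness[where f' = "\<lambda>c. c + - v"]) auto
  moreover have "card {c \<in> P. c + u \<notin> P} = card P - card {c \<in> P. c + u \<in> P}" for u
  proof -
    have "{c \<in> P. c + u \<notin> P} = P - {c \<in> P. c + u \<in> P}" by auto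
    then show ?thesis using assms by (simp add: card_Diff_subset)
  qed
  ultimately show ?thesis by (simp only:)
qed

text \<open>Halving keeps one direction of each opposite pair. Left is kept, not right, because a
  column appended on the right never changes the left neighbours of old cells.\<close>

lemma sper_eq_card_exposed:
  assumes "finite P"
  shows "sper P = card {c \<in> P. c + (- 1, 0) \<notin> P} + card {c \<in> P. c + (0, 1) \<notin> P}"
  using card_exposed_opposite[OF assms, of "(1, 0)"] card_exposed_opposite[OF assms, of "(0, 1)"]
  by (simp add: sper_def perimeter_eq_sum_directions[OF assms])

section \<open>Building a bargraph column by column\<close>

lemma bargraph_Nil [simp]: "bargraph [] = {}"
  by (auto simp: bargraph_def)

lemma mem_bargraph_snoc:
  "(i, j) \<in> bargraph (w @ [a]) \<longleftrightarrow>
     (i, j) \<in> bargraph w \<or> i = int (length w) + 1 \<and> 1 \<le> j \<and> j \<le> int a + 1"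
proof (cases "1 \<le> i \<and> i \<le> int (length w)")
  case True
  then have "nat (i - 1) < length w" by linarith
  then show ?thesis using True by (auto simp: bargraph_def nth_append)
next
  case False
  then show ?thesis by (auto simp: bargraph_def nth_append)
qed

lemma bargraph_column_bounds:
  "(i, j) \<in> bargraph w \<Longrightarrow> 1 \<le> i \<and> i \<le> int (length w)"
  by (auto simp: bargraph_def)

lemma bargraph_next_column_empty [simp]: "(int (length w) + 1, j) \<notin> bargraph w"
  by (simp add: bargraph_def)

lemma mem_bargraph_last_column:
  assumes "w \<noteq> []"
  shows "(int (length w), j) \<in> bargraph w \<longleftrightarrow> 1 \<le> j \<and> j \<le> int (last w) + 1"
proof -
  have "nat (int (length w) - 1) = length w - 1" by simp
  then show ?thesis using assms by (auto simp: bargraph_def last_conv_nth Suc_le_eq)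
qed

lemma bargraph_snoc:
  "bargraph (w @ [a]) = bargraph w \<union> {int (length w) + 1} \<times> {1..int a + 1}"
  using mem_bargraph_snoc[of _ _ w a] by auto

lemma area_bargraph_snoc: "area (bargraph (w @ [a])) = area (bargraph w) + a + 1"
proof -
  have "bargraph w \<inter> {int (length w) + 1} \<times> {1..int a + 1} = {}"
    using bargraph_column_bounds[of _ _ w] by force
  then show ?thesis
    by (simp add: area_def bargraph_snoc card_Un_disjoint finite_bargraph card_cartesian_product)
qed

lemma area_bargraph: "area (bargraph w) = length w + sum_list w"
proof (induction w rule: rev_induct)
  case Nil
  then show ?case by (simp add: area_def)
next
  case (snoc a w)
  then show ?case by (simp add: area_bargraph_snoc)
qed

lemma top_exposed_snoc:
  "{c \<in> bargraph (w @ [a]). c + (0, 1) \<notin> bargraph (w @ [a])} =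
     insert (int (length w) + 1, int a + 1) {c \<in> bargraph w. c + (0, 1) \<notin> bargraph w}"
  by (auto simp: mem_bargraph_snoc dest: bargraph_column_bounds)

text \<open>The last column of \<open>w\<close> has height \<open>last w + 1\<close>, so it leaves
  new cells exposed from row \<open>last w + 2\<close> on; for empty \<open>w\<close> nothing
  shields the new column.\<close>

lemma left_exposed_snoc:
  "{c \<in> bargraph (w @ [a]). c + (- 1, 0) \<notin> bargraph (w @ [a])} =
     {c \<in> bargraph w. c + (- 1, 0) \<notin> bargraph w} \<union>
     {int (length w) + 1} \<times> {(if w = [] then 1 else int (last w) + 2)..int a + 1}"
proof (cases "w = []")
  case True
  then show ?thesis by (auto simp: mem_bargraph_snoc[of _ _ "[]", simplified])
next
  case False
  show ?thesis
    using False
    by (auto simp: mem_bargraph_snoc mem_bargraph_last_column dest: bargraph_column_bounds)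
qed

lemma sper_empty [simp]: "sper {} = 0"
  by (simp add: sper_def perimeter_def)

text \<open>The 1 is the new top edge. The subtraction \<open>a - last w\<close> is truncated, so a
  descent adds no left edge.\<close>

lemma sper_bargraph_snoc:
  "sper (bargraph (w @ [a])) =
     sper (bargraph w) + 1 + (if w = [] then a + 1 else a - last w)"
proof -
  let ?T = "{c \<in> bargraph w. c + (0, 1) \<notin> bargraph w}"
  let ?L = "{c \<in> bargraph w. c + (- 1, 0) \<notin> bargraph w}"
  let ?N = "{int (length w) + 1} \<times> {(if w = [] then 1 else int (last w) + 2)..int a + 1}"
  have fin: "finite ?T" "finite ?L" using finite_bargraph[of w] by auto
  have "(int (length w) + 1, int a + 1) \<notin> ?T" by (auto dest: bargraph_column_bounds)
  then have "card (insert (int (length w) + 1, int a + 1) ?T) = card ?T + 1"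
    using fin by simp
  moreover have "card (?L \<union> ?N) = card ?L + card ?N"
    using fin by (intro card_Un_disjoint) (auto dest: bargraph_column_bounds)
  moreover have "card ?N = (if w = [] then a + 1 else a - last w)"
    by (auto simp: card_cartesian_product)
  ultimately show ?thesis
    by (simp only: sper_eq_card_exposed finite_bargraph top_exposed_snoc left_exposed_snoc)
qed

section \<open>Words avoiding a run of ones\<close>

lemma sublist_replicate_iff: "sublist (replicate m a) (replicate n a) \<longleftrightarrow> m \<le> n"
proof
  assume "sublist (replicate m a) (replicate n a)"
  then show "m \<le> n" using sublist_length_le by fastforce
next
  assume "m \<le> n"
  then have "replicate n a = replicate m a @ replicate (n - m) a"
    by (simp flip: replicate_add)
  then show "sublist (replicate m a) (replicate n a)" by simp
qed

text \<open>A run of \<open>a\<close> cannot contain the separator \<open>b\<close>, so every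
  occurrence stays on one side of it.\<close>

lemma sublist_replicate_separator:
  assumes "a \<noteq> b" and "0 < m"
  shows "sublist (replicate m a) (xs @ b # ys) \<longleftrightarrow>
    sublist (replicate m a) xs \<or> sublist (replicate m a) ys"
proof -
  \<comment> \<open>If an occurrence straddled the cut, its right part \<open>zs\<close> would begin
    with \<open>b\<close>.\<close>
  have no_b: "zs = []" if "replicate m a = us @ zs" "prefix zs (b # ys)" for us zs
  proof (rule ccontr)
    assume "zs \<noteq> []"
    with that(2) have "b \<in> set zs" by (cases zs) auto
    with that(1) have "b \<in> set (replicate m a)" by simp
    with assms show False by simp
  qed
  have "\<not> prefix (replicate m a) (b # ys)"
    using no_b[of "[]" "replicate m a"] assms by auto
  moreover have "sublist (replicate m a) xs"
    if "replicate m a = us @ zs" "suffix us xs" "prefix zs (b # ys)" for us zs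
    using that(1,2) no_b[OF that(1,3)] by auto
  ultimately show ?thesis
    by (auto simp: sublist_append sublist_Cons_right)
qed

text \<open>Induction from the right end: a final 0 gives \<open>i = 0\<close>, a final 1 lengthens
  the trailing run.\<close>

lemma binary_word_cases:
  assumes "set w \<subseteq> {0, 1 :: nat}"
  obtains "w = replicate (length w) 1"
    | w' i where "w = w' @ 0 # replicate i 1"
  using assms
proof (induction w arbitrary: thesis rule: rev_induct)
  case Nil
  then show ?case by simp
next
  case (snoc a w)
  consider "a = 0" | "a = 1" using snoc.prems(3) by auto
  then show ?case
  proof cases
    case 1
    then show ?thesis using snoc.prems(2)[of w 0] by simp
  next
    case 2
    show ?thesis
    proof (rule snoc.IH)
      assume "w = replicate (length w) 1"
      then show ?thesis
        using snoc.prems(1) 2 by (metis length_append_singleton replicate_Suc replicate_append_same)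
    next
      fix w' i assume "w = w' @ 0 # replicate i 1"
      then show ?thesis
        using snoc.prems(2)[of w' "Suc i"] 2 by (simp add: replicate_append_same)
    qed (use snoc.prems(3) in auto)
  qed
qed

lemma kbonacci_words_replicate: "replicate n 1 \<in> kbonacci_words n k \<longleftrightarrow> n < k"
  by (auto simp: kbonacci_words_def sublist_replicate_iff not_le)

lemma kbonacci_words_block:
  assumes "0 < k"
  shows "w @ 0 # replicate i 1 \<in> kbonacci_words n k \<longleftrightarrow>
    i < n \<and> i < k \<and> w \<in> kbonacci_words (n - 1 - i) k"
  using assms
  by (auto simp: kbonacci_words_def sublist_replicate_separator sublist_replicate_iff)

lemma kbonacci_words_decomp:
  assumes "0 < k"
  shows "kbonacci_words n k = (if n < k then {replicate n 1} else {}) \<union>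
    (\<Union>i\<in>{i. i < n \<and> i < k}. (\<lambda>w. w @ 0 # replicate i 1) ` kbonacci_words (n - 1 - i) k)"
    (is "_ = ?R")
proof (intro set_eqI iffI)
  fix w assume w: "w \<in> kbonacci_words n k"
  then have "set w \<subseteq> {0, 1}" and len: "length w = n" by (auto simp: kbonacci_words_def)
  from this(1) show "w \<in> ?R"
  proof (cases rule: binary_word_cases)
    case 1
    then show ?thesis using w len kbonacci_words_replicate[of n k] by simp
  next
    case (2 w' i)
    then show ?thesis using w kbonacci_words_block[OF assms, of w' i n] by blast
  qed
next
  fix w assume "w \<in> ?R"
  then show "w \<in> kbonacci_words n k"
    using kbonacci_words_replicate[of n k] kbonacci_words_block[OF assms, of _ _ n]
    by (auto split: if_splits)
qed

lemma finite_kbonacci_words: "finite (kbonacci_words n k)"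
proof (rule finite_subset)
  show "kbonacci_words n k \<subseteq> {w. set w \<subseteq> {0, 1} \<and> length w = n}"
    by (auto simp: kbonacci_words_def)
  show "finite {w :: nat list. set w \<subseteq> {0, 1} \<and> length w = n}"
    by (rule finite_lists_length_eq) simp
qed

lemma append_sep_replicate_inj:
  assumes "w @ 0 # replicate i 1 = w' @ 0 # replicate j (1 :: nat)"
  shows "i = j \<and> w = w'"
proof -
  \<comment> \<open>Scanning from the right stops at the separating 0, which recovers
    \<open>i\<close>.\<close>
  have *: "takeWhile (\<lambda>a. a = 1) (rev (w @ 0 # replicate i (1::nat))) = replicate i 1" for w i
    by (simp add: takeWhile_append)
  have "replicate i (1::nat) = replicate j 1"
    using *[of w i] *[of w' j] by (simp only: assms)
  then have "i = j" by (metis length_replicate)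
  with assms show ?thesis by simp
qed

lemma sum_kbonacci_words_decomp:
  fixes f :: "nat list \<Rightarrow> 'a :: comm_monoid_add"
  assumes "0 < k"
  shows "sum f (kbonacci_words n k) = (if n < k then f (replicate n 1) else 0) +
    (\<Sum>i | i < n \<and> i < k. \<Sum>w\<in>kbonacci_words (n - 1 - i) k. f (w @ 0 # replicate i 1))"
proof -
  let ?A = "\<lambda>i. (\<lambda>w. w @ 0 # replicate i 1) ` kbonacci_words (n - 1 - i) k"
  let ?I = "{i. i < n \<and> i < k}"
  have "(0::nat) \<in> set (w @ 0 # replicate i 1)" "0 \<notin> set (replicate n (1::nat))" for w i
    by auto
  then have ne: "w @ 0 # replicate i 1 \<noteq> replicate n (1::nat)" for w i by metis
  have "sum f (kbonacci_words n k) =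
      sum f (if n < k then {replicate n 1} else {}) + sum f (\<Union>i\<in>?I. ?A i)"
    by (subst kbonacci_words_decomp[OF assms], rule sum.union_disjoint)
      (auto simp: finite_kbonacci_words ne ne[symmetric] simp del: One_nat_def)
  also have "sum f (\<Union>i\<in>?I. ?A i) = (\<Sum>i\<in>?I. sum f (?A i))"
    by (rule sum.UNION_disjoint)
      (auto simp: finite_kbonacci_words dest: append_sep_replicate_inj simp del: One_nat_def)
  also have "\<dots> = (\<Sum>i\<in>?I. \<Sum>w\<in>kbonacci_words (n - 1 - i) k. f (w @ 0 # replicate i 1))"
    by (simp add: sum.reindex inj_on_def)
  finally show ?thesis by auto
qed

section \<open>The functional equation\<close>

text \<open>The empty word gets weight \<open>p\<close>, so that appending \<open>0\<close> always multiplies by \<open>p q\<close>.\<close>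

definition wt :: "nat list \<Rightarrow> rat fps fps" where
  "wt w = (if w = [] then fps_X
     else fps_X ^ sper (bargraph w) * fps_const fps_X ^ area (bargraph w))"

text \<open>Weight gained by \<open>i\<close> ones placed after a 0: each column has two cells and
  one top edge, and a nonempty run has a single rise, whence the exponent
  \<open>i + 1\<close>.\<close>

definition run_wt :: "nat \<Rightarrow> rat fps fps" where
  "run_wt i = (if i = 0 then 1 else fps_X ^ (i + 1) * fps_const fps_X ^ (2 * i))"

text \<open>Only the first appended 1 can be a rise, and it is one exactly when
  \<open>last w\<close> is 0.\<close>

lemma sper_append_ones:
  assumes "w \<noteq> []"
  shows "sper (bargraph (w @ replicate i 1)) =
    sper (bargraph w) + i + (if i = 0 then 0 else 1 - last w)"
proof (induction i)
  case (Suc i)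
  have "w @ replicate (Suc i) 1 = (w @ replicate i 1) @ [1]"
    by (simp add: replicate_append_same)
  moreover have "last (w @ replicate i 1) = (if i = 0 then last w else 1)" by simp
  ultimately show ?case
    using Suc assms by (simp only: sper_bargraph_snoc) auto
qed simp

lemma sper_replicate_ones: "0 < i \<Longrightarrow> sper (bargraph (replicate i 1)) = i + 2"
  using sper_append_ones[of "[1]" "i - 1"] sper_bargraph_snoc[of "[]" 1]
  by (cases i) simp_all

lemma wt_replicate: "wt (replicate i 1) = fps_X * run_wt i"
  by (auto simp: wt_def run_wt_def sper_replicate_ones area_bargraph sum_list_replicate mult_2
      simp del: One_nat_def simp flip: power_Suc)

lemma wt_block:
  "wt (w @ 0 # replicate i 1) = fps_X * fps_const fps_X * run_wt i * wt w"
proof -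
  have "sper (bargraph (w @ 0 # replicate i 1)) = sper (bargraph (w @ [0])) + i + (if i = 0 then 0 else 1)"
    using sper_append_ones[of "w @ [0]" i] by simp
  \<comment> \<open>When \<open>w\<close> is empty, the 0 starts the bargraph and has an exposed
    left edge; this extra 1 is the exponent of the weight \<open>p\<close> of the empty
    word.\<close>
  then have s: "sper (bargraph (w @ 0 # replicate i 1)) =
      1 + (if i = 0 then 0 else i + 1) + (if w = [] then 1 else sper (bargraph w))"
    by (simp add: sper_bargraph_snoc)
  have a: "area (bargraph (w @ 0 # replicate i 1)) = 1 + 2 * i + area (bargraph w)"
    by (simp add: area_bargraph sum_list_replicate)
  have wt: "wt w = fps_X ^ (if w = [] then 1 else sper (bargraph w)) *
      fps_const fps_X ^ area (bargraph w)" for w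
    by (simp add: wt_def area_def)
  have run: "run_wt i = fps_X ^ (if i = 0 then 0 else i + 1) * fps_const fps_X ^ (2 * i)"
    by (simp add: run_wt_def)
  have ne: "w @ 0 # replicate i 1 \<noteq> []" by simp
  show ?thesis
    unfolding wt run s a if_not_P[OF ne] power_add power_one_right by (simp only: mult_ac)
qed

section \<open>Generating series of words and of trailing runs\<close>

definition run_gf :: "nat \<Rightarrow> series" where
  "run_gf k = Abs_fps (\<lambda>i. if i < k then run_wt i else 0)"

lemma kbonacci_words_0: "0 < k \<Longrightarrow> kbonacci_words 0 k = {[]}"
  by (auto simp: kbonacci_words_def)

lemma nth_kbonacci_gf_plus:
  assumes "0 < k"
  shows "fps_nth (P_var + kbonacci_gf k) n = sum wt (kbonacci_words n k)"
proof (cases "n = 0")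
  case True
  then show ?thesis using assms by (simp add: kbonacci_words_0 P_var_def kbonacci_gf_def wt_def)
next
  case False
  then have "[] \<notin> kbonacci_words n k" by (auto simp: kbonacci_words_def)
  then show ?thesis
    using False by (auto simp: P_var_def kbonacci_gf_def wt_def intro!: sum.cong)
qed

text \<open>Cutting each word at its last 0 turns the decomposition into a product of series; the
  term \<open>P_var * run_gf k\<close> collects the words without a 0.\<close>

lemma kbonacci_gf_functional_equation:
  assumes "0 < k"
  defines "G \<equiv> P_var + kbonacci_gf k"
  shows "G = P_var * run_gf k + run_gf k * (X_var * (P_var * Q_var * G))"
proof (rule fps_ext)
  fix n
  let ?c = "fps_X * fps_const fps_X :: rat fps fps"
  have H: "fps_nth (X_var * (P_var * Q_var * G)) m =
      (if m = 0 then 0 else ?c * sum wt (kbonacci_words (m - 1) k))" for m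
    unfolding G_def X_var_def
    by (simp add: P_var_def Q_var_def nth_kbonacci_gf_plus[OF assms(1), unfolded P_var_def]
        mult.assoc del: fps_add_nth)
  \<comment> \<open>The convolution index is the length of the trailing run: \<open>i < k\<close>
    comes from \<open>run_gf\<close>, and \<open>i < n\<close> from the factor \<open>X_var\<close>,
    which accounts for the 0.\<close>
  have "fps_nth (run_gf k * (X_var * (P_var * Q_var * G))) n =
      (\<Sum>i=0..n. if i < n \<and> i < k then run_wt i * (?c * sum wt (kbonacci_words (n - 1 - i) k)) else 0)"
    unfolding fps_mult_nth[of "run_gf k"] H by (rule sum.cong) (auto simp: run_gf_def diff_right_commute)
  also have "\<dots> = (\<Sum>i | i < n \<and> i < k. run_wt i * (?c * sum wt (kbonacci_words (n - 1 - i) k)))"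
    by (subst sum.inter_filter[symmetric]) (auto intro!: sum.cong)
  also have "\<dots> = (\<Sum>i | i < n \<and> i < k. \<Sum>w\<in>kbonacci_words (n - 1 - i) k. wt (w @ 0 # replicate i 1))"
    by (simp only: wt_block sum_distrib_left mult_ac)
  finally have "fps_nth (run_gf k * (X_var * (P_var * Q_var * G))) n =
      (\<Sum>i | i < n \<and> i < k. \<Sum>w\<in>kbonacci_words (n - 1 - i) k. wt (w @ 0 # replicate i 1))" .
  moreover have "fps_nth (P_var * run_gf k) n = (if n < k then wt (replicate n 1) else 0)"
    by (simp only: wt_replicate) (simp add: P_var_def run_gf_def)
  moreover have "fps_nth G n = sum wt (kbonacci_words n k)"
    unfolding G_def by (rule nth_kbonacci_gf_plus[OF assms(1)])
  ultimately show "fps_nth G n =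
      fps_nth (P_var * run_gf k + run_gf k * (X_var * (P_var * Q_var * G))) n"
    using sum_kbonacci_words_decomp[OF assms(1), of wt n] by (simp only: fps_add_nth)
qed

lemma run_gf_geometric:
  assumes "0 < k"
  defines "v \<equiv> P_var * Q_var ^ 2 * X_var"
  shows "run_gf k * (1 - v) = 1 - v + P_var * v - P_var * v ^ k"
proof -
  let ?d = "fps_X * (fps_const fps_X)\<^sup>2 :: rat fps fps"
  have v: "v ^ i = fps_const (?d ^ i) * fps_X ^ i" for i
    by (simp add: v_def P_var_def Q_var_def X_var_def power_mult_distrib
        flip: fps_const_mult fps_const_power)
  have r: "run_wt i = fps_X * ?d ^ i" if "i > 0" for i
    using that by (simp add: run_wt_def power_mult_distrib power_mult mult.assoc)
  \<comment> \<open>The empty run weighs 1 and not \<open>p\<close>, so it is split off before the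
    geometric sum.\<close>
  have "run_gf k = 1 + P_var * (\<Sum>i\<in>{1..<k}. v ^ i)"
  proof (rule fps_ext)
    fix n
    have "fps_nth (\<Sum>i\<in>{1..<k}. v ^ i) n = (\<Sum>i\<in>{1..<k}. if n = i then ?d ^ i else 0)"
      unfolding fps_sum_nth v by (rule sum.cong) (auto simp: fps_X_power_nth)
    also have "\<dots> = (if 1 \<le> n \<and> n < k then ?d ^ n else 0)" by simp
    finally show "fps_nth (run_gf k) n = fps_nth (1 + P_var * (\<Sum>i\<in>{1..<k}. v ^ i)) n"
      using assms(1) r[of n]
      by (auto simp: run_gf_def P_var_def run_wt_def simp del: One_nat_def)
  qed
  moreover have "(\<Sum>i\<in>{1..<k}. v ^ i) * (1 - v) = v - v ^ k"
    using assms(1)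
  proof (induction k rule: nat_induct_non_zero)
    case (Suc k)
    then have "(\<Sum>i\<in>{1..<Suc k}. v ^ i) * (1 - v) = v - v ^ k + v ^ k * (1 - v)"
      by (simp add: distrib_right)
    then show ?case by (simp add: algebra_simps)
  qed simp
  then have "P_var * (\<Sum>i\<in>{1..<k}. v ^ i) * (1 - v) = P_var * (v - v ^ k)"
    by (simp only: mult.assoc)
  ultimately show ?thesis by (simp add: distrib_right right_diff_distrib')
qed

theorem theorem1p1:
  fixes k :: nat and x p q :: series
  defines "x \<equiv> X_var" and "p \<equiv> P_var" and "q \<equiv> Q_var"
  assumes "k \<ge> 2"
  shows "kbonacci_gf k =
    (p^2 * ((q + p * q^2) * x - (p * q^3 - p^2 * q^3) * x^2
            - p^k * q^(2*k) * x^k - p^(k+1) * q^(2*k+1) * x^(k+1)))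
    / (1 - (p * q + p * q^2) * x + (p^2 * q^3 - p^3 * q^3) * x^2
         + p^(k+2) * q^(2*k+1) * x^(k+1))"
    (is "_ = ?num / ?den")
proof -
  define F where "F = kbonacci_gf k"
  define R where "R = run_gf k"
  define v where "v = p * q^2 * x"
  define u where "u = p * q * x"
  define N where "N = 1 - v + p * v - p * v ^ k"
  have k: "0 < k" using assms by simp
  have G: "p + F = p * R + R * u * (p + F)"
    using kbonacci_gf_functional_equation[OF k]
    by (simp add: F_def R_def u_def x_def p_def q_def mult_ac)
  have RN: "R * (1 - v) = N"
    using run_gf_geometric[OF k] by (simp add: R_def N_def v_def x_def p_def q_def)
  \<comment> \<open>Multiplying by \<open>1 - v\<close> makes \<open>R\<close> occur only through
    \<open>R * (1 - v) = N\<close>, so the sum over runs disappears and the equation is linear in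
    \<open>F\<close>.\<close>
  have "(p + F) * (1 - v) = p * (R * (1 - v)) + (R * (1 - v)) * u * (p + F)"
    by (subst G) (simp add: algebra_simps)
  then have *: "F * (1 - v - u * N) = p * N - p * (1 - v - u * N)"
    unfolding RN by (simp add: algebra_simps)
  have vk: "v ^ k = p ^ k * q ^ (2 * k) * x ^ k"
    by (simp add: v_def power_mult_distrib power_mult)
  have den: "1 - v - u * N = ?den"
    unfolding N_def vk unfolding u_def v_def
    by (simp add: algebra_simps power2_eq_square power3_eq_cube)
  have num: "p * N - p * (1 - v - u * N) = ?num"
    unfolding N_def vk unfolding u_def v_def
    by (simp add: algebra_simps power2_eq_square power3_eq_cube)
  \<comment> \<open>Constant term 1 in \<open>x\<close> makes the denominator invertible, so the
    quotient is determined by the product equation.\<close>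
  have "fps_nth ?den 0 = 1"
    by (simp add: x_def X_var_def)
  then show ?thesis
    using *[unfolded num, unfolded den F_def] by (simp only: series_divide_eq_iff)
qed

end
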